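(* Let $\Delta_A,\Delta_B,k_A,k_B$ be positive integers satisfying at least one of the following two conditions, either as stated or with the roles of $\Delta_A$ and $\Delta_B$ exchanged and simultaneously the roles of $k_A$ and $k_B$ exchanged: (i) $k_B \ge (e\,k_A\,\Delta_B)^{1/k_A}\,\Delta_A$; (ii) $\displaystyle e\bigl(\Delta_A(\Delta_B-1)+1\bigr)\left(1-\left(1-\frac{1}{k_B}\right)^{\Delta_A\min\{1,\,k_B/k_A\}}\right)^{k_A}\le 1.$ Then every bipartite graph $G=(A\cup B,E)$ with parts $A$ and $B$, in which every vertex of $A$ has degree at most $\Delta_A$ and every vertex of $B$ has degree at most $\Delta_B$, is $(k_A,k_B)$-choosable.
   Context: All graphs are finite, simple and undirected. For a bipartite graph $G=(A\cup B,E)$ with designated parts $A$ and $B$ and positive integers $k_A,k_B$, a $(k_A,k_B)$-list-assignment is a map $L$ assigning to each vertex of $A$ a set of $k_A$ positive integers (colours) and to each vertex of $B$ a set of $k_B$ positive integers. $G$ is $(k_A,k_B)$-choosable if for every $(k_A,k_B)$-list-assignment $L$ there is a proper colouring $c$ of $G$ with $c(v)\in L(v)$ for every vertex $v$. Here $e$ is Euler's number. *)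

theory Defs
  imports Complex_Main
begin

definition simple_graph :: "'a set \<Rightarrow> 'a set set \<Rightarrow> bool" where
  "simple_graph V E \<longleftrightarrow> finite V \<and> (\<forall>e\<in>E. e \<subseteq> V \<and> card e = 2)"

text \<open>The parts are designated, and either of them may be empty.\<close>

definition bipartite_graph :: "'a set \<Rightarrow> 'a set \<Rightarrow> 'a set set \<Rightarrow> bool" where
  "bipartite_graph A B E \<longleftrightarrow>
     simple_graph (A \<union> B) E \<and> A \<inter> B = {} \<and> (\<forall>e\<in>E. \<exists>a\<in>A. \<exists>b\<in>B. e = {a, b})"

definition degree :: "'a set set \<Rightarrow> 'a \<Rightarrow> nat" where
  "degree E v = card {e \<in> E. v \<in> e}"

definition list_assignment ::
  "'a set \<Rightarrow> 'a set \<Rightarrow> nat \<Rightarrow> nat \<Rightarrow> ('a \<Rightarrow> nat set) \<Rightarrow> bool" where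
  "list_assignment A B kA kB L \<longleftrightarrow>
     (\<forall>v \<in> A \<union> B. finite (L v) \<and> (\<forall>x \<in> L v. 0 < x)) \<and>
     (\<forall>v \<in> A. card (L v) = kA) \<and> (\<forall>v \<in> B. card (L v) = kB)"

definition proper_colouring :: "'a set set \<Rightarrow> ('a \<Rightarrow> nat) \<Rightarrow> bool" where
  "proper_colouring E c \<longleftrightarrow> (\<forall>u v. {u, v} \<in> E \<longrightarrow> c u \<noteq> c v)"

definition choosable :: "'a set \<Rightarrow> 'a set \<Rightarrow> 'a set set \<Rightarrow> nat \<Rightarrow> nat \<Rightarrow> bool" where
  "choosable A B E kA kB \<longleftrightarrow>
     (\<forall>L. list_assignment A B kA kB L \<longrightarrow>
        (\<exists>c. proper_colouring E c \<and> (\<forall>v \<in> A \<union> B. c v \<in> L v)))"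

definition power_condition :: "nat \<Rightarrow> nat \<Rightarrow> nat \<Rightarrow> nat \<Rightarrow> bool" where
  "power_condition \<Delta>A \<Delta>B kA kB \<longleftrightarrow>
     real kB \<ge> (exp 1 * real kA * real \<Delta>B) powr (1 / real kA) * real \<Delta>A"

text \<open>The inner exponent need not be an integer, hence \<open>powr\<close>. For positive parameters it is
  positive, so the convention \<open>0 powr x = 0\<close>, used when \<open>kB = 1\<close>, agrees with the usual
  power.\<close>

definition probability_condition :: "nat \<Rightarrow> nat \<Rightarrow> nat \<Rightarrow> nat \<Rightarrow> bool" where
  "probability_condition \<Delta>A \<Delta>B kA kB \<longleftrightarrow>
     exp 1 * (real \<Delta>A * (real \<Delta>B - 1) + 1) *
       (1 - (1 - 1 / real kB) powr (real \<Delta>A * min 1 (real kB / real kA))) ^ kA \<le> 1"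

end

theory Submission
  imports "HOL-Probability.Product_PMF" Defs
begin

text \<open>
  Colour every \<open>b \<in> B\<close> independently and uniformly from its list. The colouring extends to
  \<open>A\<close> unless for some \<open>a \<in> A\<close> every colour of \<open>L a\<close> is used on a neighbour of \<open>a\<close>; the
  Lovasz local lemma shows that all these bad events can be avoided at once.

  Under the second condition there is one event per vertex \<open>a\<close>, which depends on at most
  \<open>\<Delta>A * (\<Delta>B - 1)\<close> others. The events ``colour \<open>c\<close> is used on \<open>N a\<close>'' are negatively
  correlated, so the probability of the bad event is at most \<open>\<Prod>c\<in>L a. 1 - (1 - 1 / kB) ^ d c\<close>,
  where \<open>d c\<close> counts the neighbours whose list contains \<open>c\<close>. As the \<open>d c\<close> add up to at most
  \<open>\<Delta>A * min kA kB\<close>, the AM-GM and Jensen inequalities give the bound in the condition.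

  Under the first condition the bad event of \<open>a\<close> is split according to an injection
  \<open>g : L a \<rightarrow> N a\<close> choosing a neighbour for each colour. Such an event has probability at most
  \<open>1 / kB ^ kA\<close> and depends on at most \<open>kA\<^sup>2 * \<Delta>B * \<Delta>A ^ (kA - 1) - 1\<close> others, which is good
  enough if \<open>kA \<le> \<Delta>A\<close>. If \<open>kA > \<Delta>A\<close>, colouring \<open>B\<close> arbitrarily never exhausts a list on
  \<open>A\<close>.
\<close>

subsection \<open>The local lemma\<close>

text \<open>Given that other events are avoided, each \<open>X i\<close> has conditional probability
  at most \<open>x\<close>, by induction on the set of events avoided. Avoiding the events one by
  one then multiplies positive factors.\<close>

lemma (in prob_space) lovasz_local_lemma:
  fixes x :: real
  assumes I: "finite I" and X: "\<And>i. i \<in> I \<Longrightarrow> X i \<in> events"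
    and x: "0 \<le> x" "x < 1"
    and p: "\<And>i. i \<in> I \<Longrightarrow> prob (X i) \<le> x * (1 - x) ^ D"
    and D: "\<And>i. i \<in> I \<Longrightarrow> finite (\<Gamma> i) \<and> card (\<Gamma> i) \<le> D"
    and indep: "\<And>i S. i \<in> I \<Longrightarrow> S \<subseteq> I - insert i (\<Gamma> i) \<Longrightarrow>
      prob (X i \<inter> (space M - \<Union> (X ` S))) = prob (X i) * prob (space M - \<Union> (X ` S))"
  shows "0 < prob (space M - \<Union> (X ` I))"
proof -
  define Av where "Av S = space M - \<Union> (X ` S)" for S
  have Av_event: "Av S \<in> events" if "S \<subseteq> I" for S
    using that I X by (auto simp: Av_def intro!: sets.Diff sets.finite_UN dest: finite_subset)
  have insert_ge: "prob (Av (insert j S)) \<ge> (1 - x) * prob (Av S)"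
    if S: "S \<subseteq> I" "j \<in> I" and le: "prob (X j \<inter> Av S) \<le> x * prob (Av S)" for j S
  proof -
    have "Av (insert j S) = Av S - X j \<inter> Av S"
      by (auto simp: Av_def)
    then have "prob (Av (insert j S)) = prob (Av S) - prob (X j \<inter> Av S)"
      using S Av_event[of S] X by (simp add: finite_measure_Diff)
    with le show ?thesis
      by (simp add: algebra_simps)
  qed
  \<comment> \<open>The conditional bound is multiplied out, so that it makes sense before
    \<open>Av S\<close> is known to have positive probability.\<close>
  have cond: "prob (X i \<inter> Av S) \<le> x * prob (Av S)"
    if "S \<subseteq> I" "i \<in> I - S" for i S
    using finite_subset[OF that(1) I] that
  proof (induction S arbitrary: i rule: finite_psubset_induct)
    case (psubset S)
    define S2 where "S2 = S - \<Gamma> i"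
    \<comment> \<open>The members of \<open>S\<close> in \<open>\<Gamma> i\<close> are put back one
      at a time; the induction hypothesis applies at each stage because \<open>S2 \<union> T\<close>
      is a proper subset of \<open>S\<close>.\<close>
    have ge: "prob (Av (S2 \<union> T)) \<ge> (1 - x) ^ card T * prob (Av S2)" if "T \<subseteq> S \<inter> \<Gamma> i" for T
    proof -
      have "finite T"
        using that psubset.hyps by (blast intro: finite_subset)
      then show ?thesis
        using that
      proof (induction T rule: finite_subset_induct')
        case (insert j T)
        have "S2 \<union> T \<subset> S"
          using insert.hyps that by (auto simp: S2_def)
        then have "prob (X j \<inter> Av (S2 \<union> T)) \<le> x * prob (Av (S2 \<union> T))"
          using insert.hyps that psubset.prems by (intro psubset.IH) (auto simp: S2_def)
        then have "(1 - x) * prob (Av (S2 \<union> T)) \<le> prob (Av (insert j (S2 \<union> T)))"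
          using insert.hyps that psubset.prems \<open>S2 \<union> T \<subset> S\<close> by (intro insert_ge) auto
        moreover have "(1 - x) * ((1 - x) ^ card T * prob (Av S2)) \<le> (1 - x) * prob (Av (S2 \<union> T))"
          using insert x by (intro mult_left_mono) auto
        ultimately show ?case
          using insert.hyps by (simp add: algebra_simps)
      qed auto
    qed
    have "card (S \<inter> \<Gamma> i) \<le> D"
      using D[of i] psubset.prems by (meson DiffD1 Int_lower2 card_mono order_trans)
    then have "(1 - x) ^ D \<le> (1 - x) ^ card (S \<inter> \<Gamma> i)"
      using x by (intro power_decreasing) auto
    then have "(1 - x) ^ D * prob (Av S2) \<le> (1 - x) ^ card (S \<inter> \<Gamma> i) * prob (Av S2)"
      by (intro mult_right_mono) auto
    also have "\<dots> \<le> prob (Av (S2 \<union> (S \<inter> \<Gamma> i)))"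
      by (rule ge) auto
    also have "S2 \<union> (S \<inter> \<Gamma> i) = S"
      by (auto simp: S2_def)
    finally have Av: "(1 - x) ^ D * prob (Av S2) \<le> prob (Av S)" .
    \<comment> \<open>Forgetting the neighbours of \<open>i\<close> enlarges the event and leaves
      one that is independent of \<open>X i\<close>; the loss is made good by
      \<open>Av\<close>.\<close>
    have "prob (X i \<inter> Av S) \<le> prob (X i \<inter> Av S2)"
      using X Av_event[of S2] psubset.prems
      by (intro finite_measure_mono) (auto simp: Av_def S2_def)
    also have "\<dots> = prob (X i) * prob (Av S2)"
      unfolding Av_def using psubset.prems by (intro indep) (auto simp: S2_def)
    also have "\<dots> \<le> x * (1 - x) ^ D * prob (Av S2)"
      using p psubset.prems by (intro mult_right_mono) auto
    also have "\<dots> \<le> x * prob (Av S)"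
      using Av x by (simp add: mult.assoc mult_left_mono)
    finally show ?case .
  qed
  have "0 < prob (Av S)" if "S \<subseteq> I" for S
    using finite_subset[OF that I] that
  proof (induction S rule: finite_subset_induct')
    case empty
    then show ?case by (simp add: Av_def prob_space)
  next
    case (insert j S)
    then have "(1 - x) * prob (Av S) \<le> prob (Av (insert j S))"
      by (intro insert_ge cond) auto
    moreover have "0 < (1 - x) * prob (Av S)"
      using insert x by simp
    ultimately show ?case by linarith
  qed
  then show ?thesis
    unfolding Av_def by blast
qed

text \<open>The weight \<open>1 / (D + 1)\<close> works for positive \<open>D\<close> because
  \<open>(1 - 1 / (D + 1)) ^ D\<close> is at least \<open>1 / e\<close>.\<close>

lemma local_lemma_weight:
  assumes "exp 1 * p * (real D + 1) \<le> 1"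
  obtains x :: real where "0 \<le> x" "x < 1" "p \<le> x * (1 - x) ^ D"
proof (cases "D = 0")
  case True
  \<comment> \<open>Here \<open>1 / (D + 1)\<close> would be 1, violating \<open>x < 1\<close>. As
    the power is trivial, any admissible weight that is at least \<open>p\<close> will do.\<close>
  show thesis
    by (rule that[of "1 / exp 1"]) (use assms True in \<open>auto simp: field_simps\<close>)
next
  case False
  define x where "x = 1 / (real D + 1)"
  have "(1 + 1 / real D) ^ D \<le> exp (1 / real D) ^ D"
    by (intro power_mono exp_ge_add_one_self) auto
  also have "\<dots> = exp 1"
    using False by (simp flip: exp_of_nat_mult)
  finally have "1 \<le> exp 1 * (1 / (1 + 1 / real D)) ^ D"
    using False by (simp add: power_one_over field_simps add_pos_pos)
  also have "1 / (1 + 1 / real D) = 1 - x"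
    using False by (simp add: x_def field_simps)
  finally have e: "1 \<le> exp 1 * (1 - x) ^ D" .
  have "exp 1 * p \<le> x"
    using assms by (simp add: x_def field_simps)
  also have "\<dots> \<le> x * (exp 1 * (1 - x) ^ D)"
    using e mult_left_mono[OF e, of x] by (simp add: x_def)
  finally have "exp 1 * p \<le> exp 1 * (x * (1 - x) ^ D)"
    by (simp add: mult_ac)
  then have "p \<le> x * (1 - x) ^ D"
    by simp
  moreover have "0 \<le> x" "x < 1"
    using False by (auto simp: x_def)
  ultimately show thesis
    by (rule that[rotated 2])
qed

section \<open>Independence and the local lemma in product distributions\<close>

lemma prob_pair_pmf_Times:
  "measure_pmf.prob (pair_pmf M N) (X \<times> Y) = measure_pmf.prob M X * measure_pmf.prob N Y"
proof -
  \<comment> \<open>The rule \<open>measure_pmf_prob_product\<close> asks for countable sets;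
    cutting down to the supports provides them.\<close>
  have "measure_pmf.prob (pair_pmf M N) (X \<times> Y)
      = measure_pmf.prob (pair_pmf M N) ((X \<inter> set_pmf M) \<times> (Y \<inter> set_pmf N))"
    by (subst measure_Int_set_pmf[symmetric], rule arg_cong[where f = "measure_pmf.prob _"]) auto
  also have "\<dots> = measure_pmf.prob M (X \<inter> set_pmf M) * measure_pmf.prob N (Y \<inter> set_pmf N)"
    by (intro measure_pmf_prob_product) auto
  finally show ?thesis
    by (simp add: measure_Int_set_pmf)
qed

text \<open>One implication suffices, since \<open>f\<close> and \<open>g\<close> may be
  exchanged.\<close>

definition depends_only_on :: "('a \<Rightarrow> 'b) set \<Rightarrow> 'a set \<Rightarrow> bool" where
  "depends_only_on X U \<longleftrightarrow> (\<forall>f g. (\<forall>u\<in>U. f u = g u) \<longrightarrow> f \<in> X \<longrightarrow> g \<in> X)"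

lemma depends_only_on_iff:
  "depends_only_on X U \<Longrightarrow> (\<And>u. u \<in> U \<Longrightarrow> f u = g u) \<Longrightarrow> f \<in> X \<longleftrightarrow> g \<in> X"
  unfolding depends_only_on_def by metis

text \<open>Splitting the product into the coordinates in \<open>U\<close> and those in
  \<open>B - U\<close> turns \<open>X \<inter> Y\<close> into a rectangle, because \<open>W\<close>
  avoids \<open>U\<close>.\<close>

lemma prob_Pi_pmf_Int:
  assumes B: "finite B" and UW: "U \<subseteq> B" "W \<subseteq> B" "U \<inter> W = {}"
    and X: "depends_only_on X U" and Y: "depends_only_on Y W"
  shows "measure_pmf.prob (Pi_pmf B d p) (X \<inter> Y)
    = measure_pmf.prob (Pi_pmf B d p) X * measure_pmf.prob (Pi_pmf B d p) Y"
proof -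
  let ?P = "Pi_pmf U d p" and ?Q = "Pi_pmf (B - U) d p"
  have eq: "measure_pmf.prob (Pi_pmf B d p) (X' \<inter> Y')
      = measure_pmf.prob ?P X' * measure_pmf.prob ?Q Y'"
    if X': "depends_only_on X' U" and Y': "depends_only_on Y' W" for X' Y'
  proof -
    have "Pi_pmf B d p = Pi_pmf (U \<union> (B - U)) d p"
      using UW by (simp add: Un_absorb1)
    also have "\<dots> = map_pmf (\<lambda>(f, g) u. if u \<in> U then f u else g u) (pair_pmf ?P ?Q)"
      using UW B by (intro Pi_pmf_union) (auto dest: finite_subset)
    finally have "measure_pmf.prob (Pi_pmf B d p) (X' \<inter> Y') = measure_pmf.prob (pair_pmf ?P ?Q)
        ((\<lambda>(f, g) u. if u \<in> U then f u else g u) -` (X' \<inter> Y'))"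
      by simp
    also have "(\<lambda>(f, g) u. if u \<in> U then f u else g u) -` (X' \<inter> Y') = X' \<times> Y'"
    proof -
      have "(\<lambda>u. if u \<in> U then f u else g u) \<in> X' \<longleftrightarrow> f \<in> X'" for f g
        using X' by (rule depends_only_on_iff) auto
      moreover have "(\<lambda>u. if u \<in> U then f u else g u) \<in> Y' \<longleftrightarrow> g \<in> Y'" for f g
        using Y' by (rule depends_only_on_iff) (use UW in auto)
      ultimately show ?thesis
        by auto
    qed
    finally show ?thesis
      by (simp add: prob_pair_pmf_Times)
  qed
  \<comment> \<open>Taking the whole space for one of the two events identifies each factor in
    \<open>eq\<close> with a probability over \<open>B\<close>.\<close>
  have UNIV: "depends_only_on UNIV V" for V
    by (simp add: depends_only_on_def)
  show ?thesis
    using eq[OF X Y] eq[OF X UNIV] eq[OF UNIV Y] by simp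
qed

text \<open>Dependence is read off the coordinates: two events are neighbours when their coordinate
  sets meet. Placing \<open>f\<close> in the support is what later keeps its values inside the
  lists.\<close>

lemma local_lemma_Pi_pmf:
  assumes I: "finite I" and B: "finite B"
    and V: "\<And>i. i \<in> I \<Longrightarrow> V i \<subseteq> B" "\<And>i. i \<in> I \<Longrightarrow> depends_only_on (X i) (V i)"
    and p: "\<And>i. i \<in> I \<Longrightarrow> measure_pmf.prob (Pi_pmf B d p) (X i) \<le> q"
    and D: "\<And>i. i \<in> I \<Longrightarrow> card {j \<in> I. j \<noteq> i \<and> V i \<inter> V j \<noteq> {}} \<le> D"
    and q: "exp 1 * q * (real D + 1) \<le> 1"
  obtains f where "f \<in> set_pmf (Pi_pmf B d p)" "\<And>i. i \<in> I \<Longrightarrow> f \<notin> X i"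
proof -
  obtain x where x: "0 \<le> x" "x < 1" "q \<le> x * (1 - x) ^ D"
    using local_lemma_weight[OF q] .
  have "0 < measure_pmf.prob (Pi_pmf B d p) (space (measure_pmf (Pi_pmf B d p)) - \<Union> (X ` I))"
  proof (rule measure_pmf.lovasz_local_lemma[where x = x and D = D
        and \<Gamma> = "\<lambda>i. {j \<in> I. j \<noteq> i \<and> V i \<inter> V j \<noteq> {}}"])
    fix i S assume i: "i \<in> I" and S: "S \<subseteq> I - insert i {j \<in> I. j \<noteq> i \<and> V i \<inter> V j \<noteq> {}}"
    have "depends_only_on (space (measure_pmf (Pi_pmf B d p)) - \<Union> (X ` S)) (\<Union> (V ` S))"
      unfolding depends_only_on_def
    proof (intro allI impI)
      fix f g assume fg: "\<forall>u\<in>\<Union> (V ` S). f u = g u"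
        and f: "f \<in> space (measure_pmf (Pi_pmf B d p)) - \<Union> (X ` S)"
      have "g \<notin> X j" if "j \<in> S" for j
        using depends_only_on_iff[OF V(2), of j f g] that S fg f by auto
      then show "g \<in> space (measure_pmf (Pi_pmf B d p)) - \<Union> (X ` S)"
        by auto
    qed
    then show "measure_pmf.prob (Pi_pmf B d p)
          (X i \<inter> (space (measure_pmf (Pi_pmf B d p)) - \<Union> (X ` S)))
        = measure_pmf.prob (Pi_pmf B d p) (X i)
          * measure_pmf.prob (Pi_pmf B d p) (space (measure_pmf (Pi_pmf B d p)) - \<Union> (X ` S))"
      using i S V B by (intro prob_Pi_pmf_Int[where U = "V i" and W = "\<Union> (V ` S)"]) auto
  qed (use I D x p in \<open>auto intro: order_trans\<close>)
  then have "set_pmf (Pi_pmf B d p) \<inter> - \<Union> (X ` I) \<noteq> {}"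
    by (metis Compl_eq_Diff_UNIV less_irrefl measure_pmf_zero_iff space_measure_pmf)
  then show thesis
    using that by auto
qed

subsection \<open>Covering a set by independent choices\<close>

lemma measure_bind_pmf:
  "measure_pmf.prob (M \<bind> N) X = measure_pmf.expectation M (\<lambda>x. measure_pmf.prob (N x) X)"
proof -
  \<comment> \<open>The Boolean image turns the event into a single point, where
    \<open>pmf_bind\<close> applies.\<close>
  have eq: "measure_pmf.prob P X = pmf (map_pmf (\<lambda>x. x \<in> X) P) True" for P
    by (auto simp: pmf_map intro!: arg_cong[where f = "measure_pmf.prob P"])
  show ?thesis
    unfolding eq map_bind_pmf pmf_bind ..
qed

text \<open>Expanding the right-hand side gives only nonnegative terms; the left-hand side keeps
  those with at most one factor \<open>y c\<close>.\<close>

lemma prod_add_ge_first_order: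
  fixes x y :: "'a \<Rightarrow> real"
  assumes "finite S" "\<And>c. c \<in> S \<Longrightarrow> 0 \<le> x c" "\<And>c. c \<in> S \<Longrightarrow> 0 \<le> y c"
  shows "(\<Prod>c\<in>S. x c) + (\<Sum>c\<in>S. y c * (\<Prod>c'\<in>S - {c}. x c')) \<le> (\<Prod>c\<in>S. x c + y c)"
  using assms
proof (induction S rule: finite_induct)
  case (insert s S)
  have "(\<Sum>c\<in>S. y c * (\<Prod>c'\<in>insert s S - {c}. x c'))
      = (\<Sum>c\<in>S. x s * (y c * (\<Prod>c'\<in>S - {c}. x c')))"
  proof (rule sum.cong)
    fix c assume "c \<in> S"
    then have "insert s S - {c} = insert s (S - {c})"
      using insert.hyps by auto
    then show "y c * (\<Prod>c'\<in>insert s S - {c}. x c') = x s * (y c * (\<Prod>c'\<in>S - {c}. x c'))"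
      using insert.hyps by (simp add: mult_ac)
  qed simp
  then have "(\<Prod>c\<in>insert s S. x c) + (\<Sum>c\<in>insert s S. y c * (\<Prod>c'\<in>insert s S - {c}. x c'))
      = x s * ((\<Prod>c\<in>S. x c) + (\<Sum>c\<in>S. y c * (\<Prod>c'\<in>S - {c}. x c'))) + y s * (\<Prod>c\<in>S. x c)"
    using insert.hyps by (simp add: algebra_simps sum_distrib_left)
  also have "\<dots> \<le> x s * (\<Prod>c\<in>S. x c + y c) + y s * (\<Prod>c\<in>S. x c + y c)"
    using insert by (intro add_mono mult_left_mono prod_mono) auto
  finally show ?case
    using insert.hyps by (simp add: algebra_simps)
qed simp

text \<open>
  In the induction step the value at the new index \<open>b\<close> is conditioned on, and the resulting bound
  is exactly the first-order part in \<open>pmf (p b)\<close> of the product on the right.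
\<close>

lemma prob_Pi_pmf_covers_le:
  assumes "finite N" "finite S"
  shows "measure_pmf.prob (Pi_pmf N d p) {f. S \<subseteq> f ` N} \<le> (\<Prod>c\<in>S. 1 - (\<Prod>b\<in>N. 1 - pmf (p b) c))"
  using assms
proof (induction N arbitrary: S rule: finite_induct)
  case empty
  then show ?case
    by (cases "S = {}") auto
next
  case (insert b N)
  define x where "x c = 1 - (\<Prod>b\<in>N. 1 - pmf (p b) c)" for c
  define G where "G T = (\<Prod>c\<in>T. x c)" for T
  have x: "0 \<le> x c" "x c \<le> 1" for c
    by (auto simp: x_def pmf_le_1 intro!: prod_le_1 prod_nonneg)
  have indicator_int: "integrable (p b) (indicator {c} :: _ \<Rightarrow> real)" for c
    by (intro measure_pmf.integrable_const_bound[where B = 1]) auto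
  have "measure_pmf.prob (Pi_pmf (insert b N) d p) {f. S \<subseteq> f ` insert b N}
      = measure_pmf.prob (p b \<bind> (\<lambda>y. map_pmf (\<lambda>f. f(b := y)) (Pi_pmf N d p))) {f. S \<subseteq> f ` insert b N}"
    using insert.hyps by (simp add: Pi_pmf_insert' map_pmf_def)
  also have "\<dots> = measure_pmf.expectation (p b)
      (\<lambda>y. measure_pmf.prob (Pi_pmf N d p) ((\<lambda>f. f(b := y)) -` {f. S \<subseteq> f ` insert b N}))"
    by (subst measure_bind_pmf) simp
  \<comment> \<open>Once \<open>y\<close> is drawn at \<open>b\<close>, the indices in
    \<open>N\<close> have only \<open>S - {y}\<close> left to cover.\<close>
  also have "\<dots> = measure_pmf.expectation (p b) (\<lambda>y. measure_pmf.prob (Pi_pmf N d p) {f. S - {y} \<subseteq> f ` N})"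
  proof -
    have "(\<lambda>f. f(b := y)) -` {f. S \<subseteq> f ` insert b N} = {f. S - {y} \<subseteq> f ` N}" for y
    proof -
      have "(f(b := y)) ` insert b N = insert y (f ` N)" for f
        using insert.hyps by auto
      then show ?thesis
        unfolding vimage_def mem_Collect_eq by blast
    qed
    then show ?thesis
      by simp
  qed
  also have "\<dots> \<le> measure_pmf.expectation (p b) (\<lambda>y. G S + (\<Sum>c\<in>S. indicator {c} y * (G (S - {c}) - G S)))"
  proof (rule integral_mono)
    show "measure_pmf.prob (Pi_pmf N d p) {f. S - {y} \<subseteq> f ` N}
        \<le> G S + (\<Sum>c\<in>S. indicator {c} y * (G (S - {c}) - G S))" for y
    proof -
      have "measure_pmf.prob (Pi_pmf N d p) {f. S - {y} \<subseteq> f ` N} \<le> G (S - {y})"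
        using insert.IH[of "S - {y}"] insert.prems by (simp add: G_def x_def)
      \<comment> \<open>At most one indicator is nonzero, so the bound becomes linear in the
        indicators and its expectation can be taken term by term.\<close>
      also have "\<dots> = G S + (\<Sum>c\<in>S. indicator {c} y * (G (S - {c}) - G S))"
        using insert.prems by (cases "y \<in> S") (auto simp: indicator_def if_distrib sum.delta cong: if_cong)
      finally show ?thesis .
    qed
  next
    show "integrable (p b) (\<lambda>y. G S + (\<Sum>c\<in>S. indicator {c} y * (G (S - {c}) - G S)))"
      by (intro Bochner_Integration.integrable_add Bochner_Integration.integrable_sum
          integrable_mult_left measure_pmf.integrable_const indicator_int)
  qed (auto intro!: measure_pmf.integrable_const_bound[where B = 1])
  also have "\<dots> = G S + (\<Sum>c\<in>S. pmf (p b) c * (G (S - {c}) - G S))"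
    by (subst Bochner_Integration.integral_add)
      (auto simp: indicator_int measure_pmf_single integral_sum integrable_mult_left
        intro!: Bochner_Integration.integrable_sum)
  also have "\<dots> = G S + (\<Sum>c\<in>S. (pmf (p b) c * (1 - x c)) * G (S - {c}))"
  proof -
    have "G S = x c * G (S - {c})" if "c \<in> S" for c
      using insert.prems that by (simp add: G_def prod.remove)
    then show ?thesis
      by (auto intro!: sum.cong simp: algebra_simps)
  qed
  also have "\<dots> \<le> (\<Prod>c\<in>S. x c + pmf (p b) c * (1 - x c))"
    unfolding G_def using insert.prems x by (intro prod_add_ge_first_order) auto
  \<comment> \<open>With \<open>r = pmf (p b) c\<close>, the factor
    \<open>x c + r * (1 - x c)\<close> equals \<open>1 - (1 - r) * (1 - x c)\<close>, and
    \<open>1 - x c\<close> is the product over \<open>N\<close>.\<close>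
  also have "\<dots> = (\<Prod>c\<in>S. 1 - (\<Prod>b\<in>insert b N. 1 - pmf (p b) c))"
    using insert.hyps by (simp add: x_def algebra_simps)
  finally show ?case .
qed

lemma prod_one_minus_power_le:
  fixes q t :: real and d :: "'a \<Rightarrow> nat"
  assumes S: "finite S" "S \<noteq> {}" and q: "0 < q" "q \<le> 1"
    and d: "real (\<Sum>c\<in>S. d c) \<le> t * real (card S)"
  shows "(\<Prod>c\<in>S. 1 - q ^ d c) \<le> (1 - q powr t) ^ card S"
proof -
  let ?n = "real (card S)"
  have n: "0 < ?n"
    using S by (simp add: card_gt_0_iff)
  have t: "(\<Sum>c\<in>S. real (d c)) / ?n \<le> t"
    using d n by (simp add: field_simps)
  \<comment> \<open>As \<open>q \<le> 1\<close>, replacing the mean exponent by the larger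
    \<open>t\<close> only lowers the power. Jensen is then applied to \<open>exp\<close> at the
    points \<open>d c * ln q\<close>.\<close>
  have "q powr t \<le> q powr ((\<Sum>c\<in>S. real (d c)) / ?n)"
    using t q by (intro powr_mono') auto
  also have "\<dots> = exp (\<Sum>c\<in>S. (1 / ?n) *\<^sub>R (real (d c) * ln q))"
    using q by (simp add: powr_def sum_distrib_right sum_divide_distrib)
  also have "\<dots> \<le> (\<Sum>c\<in>S. 1 / ?n * exp (real (d c) * ln q))"
    using S n by (intro convex_on_sum[OF _ _ exp_convex]) auto
  also have "\<dots> = (\<Sum>c\<in>S. q ^ d c) / ?n"
    using q by (simp add: sum_divide_distrib exp_of_nat_mult)
  finally have jensen: "q powr t \<le> (\<Sum>c\<in>S. q ^ d c) / ?n" .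
  have nonneg: "0 \<le> 1 - q ^ d c" for c
    using q by (simp add: power_le_one)
  \<comment> \<open>The product is rewritten as a power of a geometric mean to prepare for
    AM-GM.\<close>
  have "(\<Prod>c\<in>S. 1 - q ^ d c) = ((\<Prod>c\<in>S. 1 - q ^ d c) powr (1 / ?n)) ^ card S"
  proof -
    have "P = (P powr (1 / ?n)) ^ card S" if "0 \<le> P" for P :: real
      using that n by (cases "P = 0") (simp_all add: powr_power)
    then show ?thesis
      using nonneg by (simp add: prod_nonneg)
  qed
  also have "\<dots> \<le> (\<Sum>c\<in>S. (1 - q ^ d c) / ?n) ^ card S"
    using S nonneg by (intro power_mono arith_geom_mean) auto
  also have "(\<Sum>c\<in>S. (1 - q ^ d c) / ?n) = 1 - (\<Sum>c\<in>S. q ^ d c) / ?n"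
    using n by (simp add: sum_subtractf diff_divide_distrib flip: sum_divide_distrib)
  also have "\<dots> ^ card S \<le> (1 - q powr t) ^ card S"
  proof (intro power_mono)
    have "(\<Sum>c\<in>S. q ^ d c) \<le> ?n"
      using nonneg sum_mono[of S "\<lambda>c. q ^ d c" "\<lambda>_. 1"] by simp
    then show "0 \<le> 1 - (\<Sum>c\<in>S. q ^ d c) / ?n"
      using n by simp
  qed (use jensen in simp)
  finally show ?thesis .
qed

subsection \<open>List colourings\<close>

lemma prob_Pi_pmf_agree:
  assumes "finite B" "U \<subseteq> B"
  shows "measure_pmf.prob (Pi_pmf B d p) {f. \<forall>b\<in>U. f b = h b} = (\<Prod>b\<in>U. pmf (p b) (h b))"
proof -
  have "{f. \<forall>b\<in>U. f b = h b} = Pi B (\<lambda>b. if b \<in> U then {h b} else UNIV)"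
    using assms by (auto simp: Pi_iff split: if_splits)
  then have "measure_pmf.prob (Pi_pmf B d p) {f. \<forall>b\<in>U. f b = h b}
      = (\<Prod>b\<in>B. if b \<in> U then pmf (p b) (h b) else 1)"
    using assms by (simp add: measure_Pi_pmf_Pi measure_pmf_single if_distrib cong: if_cong)
  also have "\<dots> = (\<Prod>b\<in>U. pmf (p b) (h b))"
    using assms by (simp add: prod.If_cases Int_absorb1)
  finally show ?thesis .
qed

text \<open>Only the neighbourhoods of vertices of \<open>A\<close> are recorded, since all bad
  events sit there; the degrees on \<open>B\<close> appear as a converse count.\<close>

locale list_bipartite =
  fixes A B :: "'a set" and N :: "'a \<Rightarrow> 'a set" and L :: "'a \<Rightarrow> 'c set"
    and \<Delta>A \<Delta>B kA kB :: nat
  assumes pos: "0 < \<Delta>A" "0 < \<Delta>B" "0 < kA" "0 < kB"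
    and finite_A: "finite A" and finite_B: "finite B"
    and N_subset: "a \<in> A \<Longrightarrow> N a \<subseteq> B"
    and card_N: "a \<in> A \<Longrightarrow> card (N a) \<le> \<Delta>A"
    and card_N_converse: "b \<in> B \<Longrightarrow> card {a \<in> A. b \<in> N a} \<le> \<Delta>B"
    and finite_L: "v \<in> A \<union> B \<Longrightarrow> finite (L v)"
    and card_L_A: "a \<in> A \<Longrightarrow> card (L a) = kA"
    and card_L_B: "b \<in> B \<Longrightarrow> card (L b) = kB"
begin

lemma L_nonempty: "v \<in> A \<union> B \<Longrightarrow> L v \<noteq> {}"
  using card_L_A card_L_B pos by fastforce

lemma finite_N: "a \<in> A \<Longrightarrow> finite (N a)"
  using N_subset finite_B by (blast intro: finite_subset)

text \<open>The default value off \<open>B\<close> is harmless, as the events considered look only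
  at subsets of \<open>B\<close>.\<close>

definition random_choice :: "('a \<Rightarrow> 'c) pmf" where
  "random_choice = Pi_pmf B undefined (\<lambda>b. pmf_of_set (L b))"

lemma pmf_uniform: "b \<in> B \<Longrightarrow> pmf (pmf_of_set (L b)) c = (if c \<in> L b then 1 / real kB else 0)"
  using finite_L[of b] L_nonempty[of b] card_L_B[of b] by (simp add: indicator_def)

lemma random_choice_in_L:
  assumes "f \<in> set_pmf random_choice" "b \<in> B"
  shows "f b \<in> L b"
proof -
  have "f b \<in> set_pmf (pmf_of_set (L b))"
    using assms finite_B by (auto simp: random_choice_def set_Pi_pmf PiE_dflt_def)
  then show ?thesis
    using assms finite_L[of b] L_nonempty[of b] by simp
qed

lemma prob_covers_le:
  assumes a: "a \<in> A" and kB: "kB \<noteq> 1"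
  shows "measure_pmf.prob random_choice {f. L a \<subseteq> f ` N a}
    \<le> (1 - (1 - 1 / real kB) powr (real \<Delta>A * min 1 (real kB / real kA))) ^ kA"
proof -
  define q where "q = 1 - 1 / real kB"
  define t where "t = real \<Delta>A * min 1 (real kB / real kA)"
  define d where "d c = card {b \<in> N a. c \<in> L b}" for c
  have q: "0 < q" "q \<le> 1"
    using pos kB by (auto simp: q_def field_simps)
  have fin: "finite (L a)" "finite (N a)"
    using a finite_L finite_N by auto
  have "measure_pmf.prob random_choice {f. L a \<subseteq> f ` N a}
      = measure_pmf.prob (Pi_pmf (N a) undefined (\<lambda>b. pmf_of_set (L b))) {f. L a \<subseteq> f ` N a}"
    unfolding random_choice_def using a N_subset finite_B
    by (subst Pi_pmf_subset[of B "N a"]) (auto intro!: arg_cong[where f = "measure_pmf.prob _"])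
  also have "\<dots> \<le> (\<Prod>c\<in>L a. 1 - (\<Prod>b\<in>N a. 1 - pmf (pmf_of_set (L b)) c))"
    using fin by (intro prob_Pi_pmf_covers_le)
  also have "\<dots> = (\<Prod>c\<in>L a. 1 - q ^ d c)"
  proof -
    have "(\<Prod>b\<in>N a. 1 - pmf (pmf_of_set (L b)) c) = (\<Prod>b\<in>N a. if c \<in> L b then q else 1)" for c
      using N_subset[OF a] by (intro prod.cong) (auto simp: pmf_uniform q_def subset_iff)
    also have "\<dots> c = q ^ d c" for c
      using fin by (simp add: prod.If_cases d_def Int_def)
    finally show ?thesis
      by simp
  qed
  also have "\<dots> \<le> (1 - q powr t) ^ card (L a)"
  proof (rule prod_one_minus_power_le)
    \<comment> \<open>Double counting of the pairs of a neighbour \<open>b\<close> and a colour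
      common to \<open>L a\<close> and \<open>L b\<close>.\<close>
    have "(\<Sum>c\<in>L a. d c) = (\<Sum>b\<in>N a. card {c \<in> L a. c \<in> L b})"
      unfolding d_def card_eq_sum using fin by (intro sum.swap_restrict)
    also have "\<dots> \<le> card (N a) * min kA kB"
    proof (rule sum_bounded_above[THEN order_trans])
      fix b assume "b \<in> N a"
      then have b: "b \<in> B"
        using a N_subset by auto
      have "card {c \<in> L a. c \<in> L b} \<le> card (L a)" "card {c \<in> L a. c \<in> L b} \<le> card (L b)"
        using fin finite_L[of b] b by (auto intro!: card_mono)
      then show "card {c \<in> L a. c \<in> L b} \<le> min kA kB"
        using a b card_L_A card_L_B by simp
    qed simp
    also have "\<dots> \<le> \<Delta>A * min kA kB"
      using a card_N by simp
    finally have "real (\<Sum>c\<in>L a. d c) \<le> real \<Delta>A * real (min kA kB)"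
      by (metis of_nat_le_iff of_nat_mult)
    also have "\<dots> = t * real (card (L a))"
      using a card_L_A pos by (auto simp: t_def min_def field_simps)
    finally show "real (\<Sum>c\<in>L a. d c) \<le> t * real (card (L a))" .
  qed (use fin a L_nonempty q in auto)
  finally show ?thesis
    using a card_L_A by (simp add: q_def t_def)
qed

lemma good_choice_probability:
  assumes "probability_condition \<Delta>A \<Delta>B kA kB"
  obtains f where "\<And>b. b \<in> B \<Longrightarrow> f b \<in> L b" "\<And>a. a \<in> A \<Longrightarrow> \<not> L a \<subseteq> f ` N a"
proof -
  define Q where "Q = (1 - (1 - 1 / real kB) powr (real \<Delta>A * min 1 (real kB / real kA))) ^ kA"
  have D: "real \<Delta>A * (real \<Delta>B - 1) = real (\<Delta>A * (\<Delta>B - 1))"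
    using pos by (simp add: of_nat_diff)
  have Q: "exp 1 * Q * (real (\<Delta>A * (\<Delta>B - 1)) + 1) \<le> 1"
    using assms unfolding probability_condition_def D Q_def by (simp add: mult_ac)
  \<comment> \<open>For \<open>kB = 1\<close> the base of \<open>powr\<close> is 0, so
    \<open>Q = 1\<close> and the condition would force \<open>e\<close> to be at most 1. Excluding
    this case makes \<open>q\<close> positive in \<open>prob_covers_le\<close>.\<close>
  have kB: "kB \<noteq> 1"
  proof
    assume "kB = 1"
    then have "exp 1 * (real (\<Delta>A * (\<Delta>B - 1)) + 1) \<le> 1"
      using Q by (simp add: Q_def)
    moreover have "exp 1 * 1 \<le> exp 1 * (real (\<Delta>A * (\<Delta>B - 1)) + 1)"
      by (intro mult_left_mono) auto
    moreover have "(1::real) < exp 1"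
      by simp
    ultimately show False
      by linarith
  qed
  show thesis
  proof (rule local_lemma_Pi_pmf[where I = A and B = B and V = N and X = "\<lambda>a. {f. L a \<subseteq> f ` N a}"
        and d = undefined and p = "\<lambda>b. pmf_of_set (L b)" and q = Q and D = "\<Delta>A * (\<Delta>B - 1)"])
    fix a assume a: "a \<in> A"
    show "depends_only_on {f. L a \<subseteq> f ` N a} (N a)"
      unfolding depends_only_on_def by (metis (no_types, lifting) image_cong mem_Collect_eq)
    show "measure_pmf.prob (Pi_pmf B undefined (\<lambda>b. pmf_of_set (L b))) {f. L a \<subseteq> f ` N a} \<le> Q"
      using prob_covers_le[OF a kB] by (simp add: Q_def random_choice_def)
    \<comment> \<open>Removing \<open>a\<close> from the star of each of its neighbours is what
      gives \<open>\<Delta>B - 1\<close> instead of \<open>\<Delta>B\<close>.\<close>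
    have "{a' \<in> A. a' \<noteq> a \<and> N a \<inter> N a' \<noteq> {}} \<subseteq> (\<Union>b\<in>N a. {a' \<in> A. b \<in> N a'} - {a})"
      by auto
    then have "card {a' \<in> A. a' \<noteq> a \<and> N a \<inter> N a' \<noteq> {}} \<le> card (\<Union>b\<in>N a. {a' \<in> A. b \<in> N a'} - {a})"
      using a finite_A finite_N by (intro card_mono) auto
    also have "\<dots> \<le> (\<Sum>b\<in>N a. card ({a' \<in> A. b \<in> N a'} - {a}))"
      using a finite_N by (intro card_UN_le) auto
    also have "\<dots> \<le> card (N a) * (\<Delta>B - 1)"
    proof (rule sum_bounded_above[THEN order_trans])
      fix b assume b: "b \<in> N a"
      have "card ({a' \<in> A. b \<in> N a'} - {a}) = card {a' \<in> A. b \<in> N a'} - 1"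
        using a b finite_A by (subst card_Diff_singleton) auto
      also have "\<dots> \<le> \<Delta>B - 1"
        using a b N_subset card_N_converse[of b] by (intro diff_le_mono) auto
      finally show "card ({a' \<in> A. b \<in> N a'} - {a}) \<le> \<Delta>B - 1" .
    qed simp
    also have "\<dots> \<le> \<Delta>A * (\<Delta>B - 1)"
      using a card_N by simp
    finally show "card {a' \<in> A. a' \<noteq> a \<and> N a \<inter> N a' \<noteq> {}} \<le> \<Delta>A * (\<Delta>B - 1)" .
  next
    fix f assume f: "f \<in> set_pmf (Pi_pmf B undefined (\<lambda>b. pmf_of_set (L b)))"
      and "\<And>a. a \<in> A \<Longrightarrow> f \<notin> {f. L a \<subseteq> f ` N a}"
    then show thesis
      by (intro that[of f] random_choice_in_L[of f]) (auto simp: random_choice_def)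
  qed (use finite_A finite_B N_subset Q in auto)
qed

lemma good_choice_power:
  assumes "power_condition \<Delta>A \<Delta>B kA kB"
  obtains f where "\<And>b. b \<in> B \<Longrightarrow> f b \<in> L b" "\<And>a. a \<in> A \<Longrightarrow> \<not> L a \<subseteq> f ` N a"
proof (cases "kA \<le> \<Delta>A")
  case False
  define f where "f b = (SOME c. c \<in> L b)" for b
  have "\<not> L a \<subseteq> f ` N a" if a: "a \<in> A" for a
  proof
    assume "L a \<subseteq> f ` N a"
    then have "card (L a) \<le> card (N a)"
      using finite_N[OF a] by (rule surj_card_le[rotated])
    then show False
      using a card_L_A card_N[OF a] False by simp
  qed
  then show thesis
    using that[of f] L_nonempty by (auto simp: f_def some_in_eq)
next
  case True
  \<comment> \<open>Injectivity makes the \<open>kA\<close> requirements on \<open>f\<close> concern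
    distinct coordinates, hence independent ones.\<close>
  define G where "G a = {g \<in> L a \<rightarrow>\<^sub>E N a. inj_on g (L a)}" for a
  define U where "U = (\<lambda>(a, g :: 'c \<Rightarrow> 'a). g ` L a)"
  define X where "X = (\<lambda>(a, g). {f :: 'a \<Rightarrow> 'c. \<forall>c\<in>L a. f (g c) = c})"
  \<comment> \<open>\<open>K\<close> bounds the number of events sharing a coordinate with a given
    one, that one included; hence the degree \<open>K - 1\<close> below.\<close>
  define K where "K = kA * kA * \<Delta>B * \<Delta>A ^ (kA - 1)"
  define I where "I = Sigma A G"
  have K: "0 < K"
    using pos by (simp add: K_def)
  have finite_G: "finite (G a)" if "a \<in> A" for a
    using that finite_L finite_N by (auto simp: G_def finite_PiE)
  have finite_I: "finite I"
    using finite_A finite_G by (auto simp: I_def)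
  have card_through: "card {j \<in> I. b \<in> U j} \<le> \<Delta>B * (kA * \<Delta>A ^ (kA - 1))" if b: "b \<in> B" for b
  proof -
    \<comment> \<open>For an event through \<open>b\<close>, there are at most
      \<open>\<Delta>B\<close> choices of \<open>a\<close>, then \<open>kA\<close> choices of the
      colour \<open>c\<close> sent to \<open>b\<close>, and at most \<open>\<Delta>A\<close> images
      for each other colour. Injectivity is dropped in this count.\<close>
    let ?H = "\<lambda>a c. PiE (L a) (\<lambda>c'. if c' = c then {b} else N a)"
    have H: "finite (?H a c)" "card (?H a c) \<le> \<Delta>A ^ (kA - 1)" if "a \<in> A" "c \<in> L a" for a c
    proof -
      show "finite (?H a c)"
        using that finite_L finite_N by (auto intro: finite_PiE)
      have "card (?H a c) = (\<Prod>c'\<in>L a. if c' = c then 1 else card (N a))"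
        using that finite_L by (subst card_PiE) (auto intro!: prod.cong)
      also have "\<dots> = card (N a) ^ (kA - 1)"
        using that finite_L[of a] card_L_A by (simp add: prod.remove[of _ c])
      also have "\<dots> \<le> \<Delta>A ^ (kA - 1)"
        using that card_N by (intro power_mono) auto
      finally show "card (?H a c) \<le> \<Delta>A ^ (kA - 1)" .
    qed
    have "{j \<in> I. b \<in> U j} \<subseteq> (SIGMA a:{a \<in> A. b \<in> N a}. \<Union>c\<in>L a. ?H a c)"
      by (fastforce simp: I_def U_def G_def PiE_iff)
    then have "card {j \<in> I. b \<in> U j} \<le> card (SIGMA a:{a \<in> A. b \<in> N a}. \<Union>c\<in>L a. ?H a c)"
      using H finite_A finite_L by (intro card_mono finite_SigmaI) auto
    also have "\<dots> = (\<Sum>a\<in>{a \<in> A. b \<in> N a}. card (\<Union>c\<in>L a. ?H a c))"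
      using H finite_A finite_L by (intro card_SigmaI) auto
    also have "\<dots> \<le> card {a \<in> A. b \<in> N a} * (kA * \<Delta>A ^ (kA - 1))"
    proof (rule sum_bounded_above[THEN order_trans])
      fix a assume a: "a \<in> {a \<in> A. b \<in> N a}"
      have "card (\<Union>c\<in>L a. ?H a c) \<le> (\<Sum>c\<in>L a. card (?H a c))"
        using a finite_L by (intro card_UN_le) auto
      also have "\<dots> \<le> card (L a) * \<Delta>A ^ (kA - 1)"
        using a H by (intro sum_bounded_above[THEN order_trans]) auto
      finally show "card (\<Union>c\<in>L a. ?H a c) \<le> kA * \<Delta>A ^ (kA - 1)"
        using a card_L_A by simp
    qed simp
    also have "\<dots> \<le> \<Delta>B * (kA * \<Delta>A ^ (kA - 1))"
      using b card_N_converse by (intro mult_right_mono) auto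
    finally show ?thesis .
  qed
  have prob: "measure_pmf.prob random_choice (X i) \<le> (1 / real kB) ^ kA" if i: "i \<in> I" for i
  proof -
    obtain a g where [simp]: "i = (a, g)" and a: "a \<in> A" and g: "g \<in> L a \<rightarrow>\<^sub>E N a" "inj_on g (L a)"
      using i by (auto simp: I_def G_def)
    have sub: "g ` L a \<subseteq> B"
      using a g N_subset by fastforce
    \<comment> \<open>Indexing the requirements by the image of \<open>g\<close> expresses the event
      as agreement with a fixed function there.\<close>
    have "X i = {f. \<forall>b\<in>g ` L a. f b = inv_into (L a) g b}"
      using g by (auto simp: X_def)
    then have "measure_pmf.prob random_choice (X i)
        = (\<Prod>b\<in>g ` L a. pmf (pmf_of_set (L b)) (inv_into (L a) g b))"
      using sub finite_B by (simp only: random_choice_def prob_Pi_pmf_agree)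
    also have "\<dots> \<le> (\<Prod>b\<in>g ` L a. 1 / real kB)"
      using sub by (intro prod_mono) (auto simp: pmf_uniform)
    also have "\<dots> = (1 / real kB) ^ kA"
      using a g card_L_A by (simp add: card_image)
    finally show ?thesis .
  qed
  \<comment> \<open>This is the power condition raised to the power \<open>kA\<close>.\<close>
  have "exp 1 * real kA * real \<Delta>B * real \<Delta>A ^ kA
      = ((exp 1 * real kA * real \<Delta>B) powr (1 / real kA) * real \<Delta>A) ^ kA"
    using pos by (simp add: power_mult_distrib powr_power)
  also have "\<dots> \<le> real kB ^ kA"
    using assms by (intro power_mono) (auto simp: power_condition_def)
  finally have "exp 1 * real kA * real \<Delta>B * real \<Delta>A ^ kA \<le> real kB ^ kA" .
  moreover have "real K \<le> real (kA * \<Delta>B * \<Delta>A ^ kA)"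
  proof -
    \<comment> \<open>The case assumption \<open>kA \<le> \<Delta>A\<close> trades one factor
      \<open>kA\<close> for the missing factor \<open>\<Delta>A\<close>.\<close>
    have "K \<le> kA * \<Delta>A * \<Delta>B * \<Delta>A ^ (kA - 1)"
      unfolding K_def using True by (intro mult_right_mono mult_left_mono) auto
    also have "\<dots> = kA * \<Delta>B * \<Delta>A ^ kA"
      using pos by (cases kA) (auto simp: algebra_simps)
    finally show ?thesis
      by (rule of_nat_mono)
  qed
  then have "exp 1 * real K \<le> exp 1 * real kA * real \<Delta>B * real \<Delta>A ^ kA"
    using mult_left_mono[of "real K" _ "exp 1"] by (simp add: mult.assoc)
  ultimately have "exp 1 * real K \<le> real kB ^ kA"
    by linarith
  then have Q: "exp 1 * (1 / real kB) ^ kA * (real (K - 1) + 1) \<le> 1"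
    using pos K by (simp add: power_one_over field_simps of_nat_diff)
  show thesis
  proof (rule local_lemma_Pi_pmf[where I = I and B = B and V = U and X = X and d = undefined
        and p = "\<lambda>b. pmf_of_set (L b)" and q = "(1 / real kB) ^ kA" and D = "K - 1"])
    fix i assume i: "i \<in> I"
    then obtain a g where [simp]: "i = (a, g)" and a: "a \<in> A"
      and g: "g \<in> L a \<rightarrow>\<^sub>E N a" "inj_on g (L a)"
      by (auto simp: I_def G_def)
    show sub: "U i \<subseteq> B"
      using a g N_subset by (fastforce simp: U_def)
    show "depends_only_on (X i) (U i)"
      by (auto simp: depends_only_on_def X_def U_def)
    show "measure_pmf.prob (Pi_pmf B undefined (\<lambda>b. pmf_of_set (L b))) (X i) \<le> (1 / real kB) ^ kA"
      using prob[OF i] by (simp add: random_choice_def)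
    have U: "finite (U i)" "card (U i) = kA"
      using a g finite_L card_L_A by (auto simp: U_def card_image)
    have "{j \<in> I. j \<noteq> i \<and> U i \<inter> U j \<noteq> {}} \<subseteq> (\<Union>b\<in>U i. {j \<in> I. b \<in> U j}) - {i}"
      by auto
    then have "card {j \<in> I. j \<noteq> i \<and> U i \<inter> U j \<noteq> {}} \<le> card ((\<Union>b\<in>U i. {j \<in> I. b \<in> U j}) - {i})"
      using U finite_I by (intro card_mono) auto
    also have "\<dots> = card (\<Union>b\<in>U i. {j \<in> I. b \<in> U j}) - 1"
    proof (rule card_Diff_singleton)
      have "U i \<noteq> {}"
        using U pos by auto
      then show "i \<in> (\<Union>b\<in>U i. {j \<in> I. b \<in> U j})"
        using i by auto
    qed
    also have "\<dots> \<le> K - 1"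
    proof (rule diff_le_mono)
      have "card (\<Union>b\<in>U i. {j \<in> I. b \<in> U j}) \<le> (\<Sum>b\<in>U i. card {j \<in> I. b \<in> U j})"
        using U by (intro card_UN_le)
      also have "\<dots> \<le> card (U i) * (\<Delta>B * (kA * \<Delta>A ^ (kA - 1)))"
        using card_through sub by (intro sum_bounded_above[THEN order_trans]) auto
      finally show "card (\<Union>b\<in>U i. {j \<in> I. b \<in> U j}) \<le> K"
        using U by (simp add: K_def mult_ac)
    qed
    finally show "card {j \<in> I. j \<noteq> i \<and> U i \<inter> U j \<noteq> {}} \<le> K - 1" .
  next
    fix f assume f: "f \<in> set_pmf (Pi_pmf B undefined (\<lambda>b. pmf_of_set (L b)))"
      and avoid: "\<And>i. i \<in> I \<Longrightarrow> f \<notin> X i"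
    have "\<not> L a \<subseteq> f ` N a" if a: "a \<in> A" for a
    proof
      assume "L a \<subseteq> f ` N a"
      then have "\<forall>c\<in>L a. \<exists>b\<in>N a. f b = c"
        by auto
      then obtain g where g: "\<And>c. c \<in> L a \<Longrightarrow> g c \<in> N a \<and> f (g c) = c"
        by metis
      \<comment> \<open>Since \<open>f\<close> is a left inverse of \<open>g\<close>, injectivity
        comes for free.\<close>
      have "inj_on (restrict g (L a)) (L a)"
        using g by (intro inj_on_inverseI[where g = f]) auto
      then have "(a, restrict g (L a)) \<in> I"
        using a g by (auto simp: I_def G_def)
      moreover have "f \<in> X (a, restrict g (L a))"
        using g by (auto simp: X_def)
      ultimately show False
        using avoid by blast
    qed
    then show thesis
      using f by (intro that[of f] random_choice_in_L[of f]) (auto simp: random_choice_def)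
  qed (use finite_I finite_B Q in auto)
qed

end

section \<open>From a good choice on \<open>B\<close> to a list colouring\<close>

lemma choosable_if_one_sided:
  fixes A B :: "'a set" and E :: "'a set set"
  assumes pos: "0 < \<Delta>A" "0 < \<Delta>B" "0 < kA" "0 < kB"
    and cond: "power_condition \<Delta>A \<Delta>B kA kB \<or> probability_condition \<Delta>A \<Delta>B kA kB"
    and graph: "bipartite_graph A B E"
    and dA: "\<forall>v\<in>A. degree E v \<le> \<Delta>A"
    and dB: "\<forall>v\<in>B. degree E v \<le> \<Delta>B"
  shows "choosable A B E kA kB"
  unfolding choosable_def
proof (intro allI impI)
  fix L assume L: "list_assignment A B kA kB L"
  define N where "N v = {u. {v, u} \<in> E}" for v
  have fin: "finite A" "finite B" and disj: "A \<inter> B = {}" and "E \<subseteq> Pow (A \<union> B)"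
    using graph by (auto simp: bipartite_graph_def simple_graph_def)
  then have finite_E: "finite E"
    by (meson finite_Pow_iff finite_UnI finite_subset)
  have edge: "u \<in> A \<and> v \<in> B \<or> u \<in> B \<and> v \<in> A" if "{u, v} \<in> E" for u v
    using that graph by (fastforce simp: bipartite_graph_def doubleton_eq_iff)
  have degree: "card (N v) \<le> degree E v" for v
    unfolding degree_def
  proof (rule card_inj_on_le[where f = "\<lambda>u. {v, u}"])
    show "inj_on (\<lambda>u. {v, u}) (N v)"
      by (auto simp: inj_on_def doubleton_eq_iff)
  qed (use finite_E in \<open>auto simp: N_def\<close>)
  interpret list_bipartite A B N L \<Delta>A \<Delta>B kA kB
  proof
    fix a assume "a \<in> A"
    then show "N a \<subseteq> B" "card (N a) \<le> \<Delta>A"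
      using edge disj degree[of a] dA by (fastforce simp: N_def)+
  next
    fix b assume b: "b \<in> B"
    have "{a \<in> A. b \<in> N a} = N b"
      using b edge disj by (fastforce simp: N_def insert_commute)
    then show "card {a \<in> A. b \<in> N a} \<le> \<Delta>B"
      using degree[of b] dB b by fastforce
  qed (use pos fin L in \<open>auto simp: list_assignment_def\<close>)
  obtain f where f: "\<And>b. b \<in> B \<Longrightarrow> f b \<in> L b" "\<And>a. a \<in> A \<Longrightarrow> \<not> L a \<subseteq> f ` N a"
  proof -
    from cond show thesis
    proof
      assume "power_condition \<Delta>A \<Delta>B kA kB"
      then show thesis
        by (rule good_choice_power) (rule that)
    next
      assume "probability_condition \<Delta>A \<Delta>B kA kB"
      then show thesis
        by (rule good_choice_probability) (rule that)
    qed
  qed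
  define c where "c v = (if v \<in> A then SOME x. x \<in> L v - f ` N v else f v)" for v
  have c_A: "c a \<in> L a - f ` N a" if "a \<in> A" for a
  proof -
    have "\<exists>x. x \<in> L a - f ` N a"
      using f(2)[OF that] by blast
    then have "(SOME x. x \<in> L a - f ` N a) \<in> L a - f ` N a"
      by (rule someI_ex)
    with that show ?thesis
      by (simp add: c_def)
  qed
  have c_B: "c b = f b" if "b \<in> B" for b
    using that disj by (auto simp: c_def)
  have "c a \<noteq> c b" if "{a, b} \<in> E" "a \<in> A" "b \<in> B" for a b
    using that c_A[of a] c_B[of b] by (auto simp: N_def)
  then have "proper_colouring E c"
    unfolding proper_colouring_def using edge by (metis insert_commute)
  moreover have "\<forall>v\<in>A \<union> B. c v \<in> L v"
    using c_A c_B f(1) by auto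
  ultimately show "\<exists>c. proper_colouring E c \<and> (\<forall>v\<in>A \<union> B. c v \<in> L v)"
    by blast
qed

text \<open>Exchanging the parts reduces the two swapped conditions of the theorem to the one-sided
  statement.\<close>

lemma bipartite_graph_commute: "bipartite_graph A B E \<longleftrightarrow> bipartite_graph B A E"
  unfolding bipartite_graph_def by (metis Int_commute Un_commute insert_commute)

lemma choosable_commute: "choosable A B E kA kB \<longleftrightarrow> choosable B A E kB kA"
  unfolding choosable_def list_assignment_def by (simp add: Un_commute conj_commute)

theorem theorem1p4:
  fixes \<Delta>A \<Delta>B kA kB :: nat
    and A B :: "'a set" and E :: "'a set set"
  assumes "0 < \<Delta>A" "0 < \<Delta>B" "0 < kA" "0 < kB"
    and "power_condition \<Delta>A \<Delta>B kA kB \<or> probability_condition \<Delta>A \<Delta>B kA kB \<or>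
         power_condition \<Delta>B \<Delta>A kB kA \<or> probability_condition \<Delta>B \<Delta>A kB kA"
    and "bipartite_graph A B E"
    and "\<forall>v\<in>A. degree E v \<le> \<Delta>A"
    and "\<forall>v\<in>B. degree E v \<le> \<Delta>B"
  shows "choosable A B E kA kB"
  using assms choosable_if_one_sided[of \<Delta>A \<Delta>B kA kB A B E]
    choosable_if_one_sided[of \<Delta>B \<Delta>A kB kA B A E]
    bipartite_graph_commute[of A B E] choosable_commute[of A B E kA kB]
  by blast

end
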